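(* Let $\bar A=\bar T+\bar D+\bar T^{T}$ be an arbitrary $n\times n$ real symmetric matrix satisfying $\|\bar A\|_2\le\sqrt n$, where $\bar T$ is lower-triangular with zeros on the diagonal and $\bar D$ is diagonal. Let $0<\sigma^2\le 1$, let $T$ be a zero-preserving perturbation of $\bar T$ of variance $\sigma^2$, let $G_D$ be a diagonal matrix whose diagonal entries are independent Gaussian random variables of mean $0$ and variance $\sigma^2$ that are independent of $T$, and let $D=\bar D+G_D$. Then, for $A=T+D+T^{T}$ and every $x\ge 1$, $$\Pr\left[\kappa(A)\ge x\right]\le 6\sqrt{\frac2\pi}\,\frac{n^{7/2}}{x\,\sigma}\left(1+\sqrt{2\ln(x)/(9n)}\right).$$
   Context: $\|\cdot\|_2$ is the operator norm induced by the Euclidean norm, and $\kappa(A)=\|A\|_2\|A^{-1}\|_2$ is the condition number ($A$ is invertible with probability 1). The zero-preserving perturbation of a matrix $\bar T$ of variance $\sigma^2$ is the random matrix $T$ obtained by adding independent Gaussian random variables of mean $0$ and variance $\sigma^2$ to the non-zero entries of $\bar T$ (zero entries are left unchanged). *)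

theory Defs
  imports "HOL-Probability.Probability"
begin

text \<open>
  The norm of \<^typ>\<open>real ^ 'n\<close> is the Euclidean one, so \<^const>\<open>onorm\<close> of
  the map \<open>v \<mapsto> A v\<close> is the operator norm induced by it.
\<close>

definition op_norm :: "real ^ 'n ^ 'n \<Rightarrow> real" where
  "op_norm A = onorm (\<lambda>v. A *v v)"

text \<open>
  On singular \<open>A\<close>, where \<^const>\<open>matrix_inv\<close> is an unspecified constant matrix,
  the value carries no meaning.
\<close>

definition cond_number :: "real ^ 'n ^ 'n \<Rightarrow> real" where
  "cond_number A = op_norm A * op_norm (matrix_inv A)"

definition diagonal_matrix :: "real ^ 'n ^ 'n \<Rightarrow> bool" where
  "diagonal_matrix D \<longleftrightarrow> (\<forall>i j. i \<noteq> j \<longrightarrow> D $ i $ j = 0)"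

definition strictly_lower_triangular :: "real ^ ('n::{finite,linorder}) ^ ('n::{finite,linorder}) \<Rightarrow> bool" where
  "strictly_lower_triangular T \<longleftrightarrow> (\<forall>i j. i \<le> j \<longrightarrow> T $ i $ j = 0)"

text \<open>
  \<^const>\<open>normal_density\<close> takes the standard deviation, so \<open>\<sigma>\<close> below is the standard
  deviation and the variance is \<open>\<sigma>\<^sup>2\<close>. Independence is joint independence of the family.
\<close>

definition indep_gaussians :: "'w measure \<Rightarrow> real \<Rightarrow> ('i \<Rightarrow> 'w \<Rightarrow> real) \<Rightarrow> 'i set \<Rightarrow> bool" where
  "indep_gaussians M \<sigma> g I \<longleftrightarrow>
     prob_space.indep_vars M (\<lambda>_. borel) g I \<and>
     (\<forall>i\<in>I. distributed M lborel (g i) (normal_density 0 \<sigma>))"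

definition zero_preserving_perturbation ::
    "'w measure \<Rightarrow> real \<Rightarrow> real ^ 'n ^ 'n \<Rightarrow> ('w \<Rightarrow> real ^ 'n ^ 'n) \<Rightarrow> bool" where
  "zero_preserving_perturbation M \<sigma> Tbar T \<longleftrightarrow>
     (\<exists>g :: 'n \<times> 'n \<Rightarrow> 'w \<Rightarrow> real.
        indep_gaussians M \<sigma> g {(i, j). Tbar $ i $ j \<noteq> 0} \<and>
        (\<forall>\<omega>\<in>space M. \<forall>i j. T \<omega> $ i $ j =
            (if Tbar $ i $ j = 0 then 0 else Tbar $ i $ j + g (i, j) \<omega>)))"

end

theory Submission
  imports Defs
begin

text \<open>
  A symmetric \<open>A\<close> with \<open>\<kappa>(A) \<ge> x\<close> and \<open>\<parallel>A\<parallel> \<le> s\<close> has an eigenvalue in \<open>[-s/x, s/x]\<close>, so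
  for \<open>\<epsilon> > s/x\<close> the negative index of inertia of \<open>A - \<epsilon>I\<close> exceeds that of \<open>A + \<epsilon>I\<close>. Passing
  from one matrix to the other one diagonal entry at a time, the index is, as a function of a single
  diagonal entry, a decreasing step function with at most one jump, of height one. Hence
  each step changes the index with probability at most \<open>2\<epsilon>\<close> times the maximum of the Gaussian
  density (a Wegner estimate), whatever the off-diagonal entries are. The
  bound \<open>s\<close> on the norm comes from truncating every Gaussian at \<open>sqrt (2 ln x + 2)\<close>.
\<close>

section \<open>The negative index of inertia\<close>

definition negative_on :: "real^'n^'n \<Rightarrow> (real^'n) set \<Rightarrow> bool" where
  "negative_on B S \<longleftrightarrow> (\<forall>v\<in>S. v \<noteq> 0 \<longrightarrow> v \<bullet> (B *v v) < 0)"

text \<open>For symmetric \<open>B\<close> this is the number of negative eigenvalues, counted with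
  multiplicity. The variational form turns monotonicity, interlacing and semicontinuity into
  statements about one optimal subspace.\<close>

definition neg_index :: "real^'n^'n \<Rightarrow> nat" where
  "neg_index B = Max {dim S | S. subspace S \<and> negative_on B S}"

lemma neg_index_finite: "finite {dim S | S. subspace S \<and> negative_on (B :: real^'n^'n) S}"
  by (rule finite_subset[of _ "{..CARD('n)}"]) (auto simp: dim_subset_UNIV_cart)

lemma dim_le_neg_index:
  assumes "subspace S" "negative_on B S"
  shows "dim S \<le> neg_index B"
  unfolding neg_index_def using assms by (intro Max_ge[OF neg_index_finite]) auto

lemma neg_index_attained:
  obtains S where "subspace S" "negative_on B S" "dim S = neg_index B"
proof -
  \<comment> \<open>The zero subspace is vacuously negative, so the maximum is over a nonempty
    set.\<close>
  have "dim {0 :: real^'a} \<in> {dim S | S. subspace S \<and> negative_on B S}"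
    unfolding negative_on_def using subspace_single_0 by blast
  then have "neg_index B \<in> {dim S | S. subspace S \<and> negative_on B S}"
    unfolding neg_index_def by (intro Max_in neg_index_finite) blast
  then show thesis using that by force
qed

lemma neg_index_antimono:
  assumes "\<And>v. v \<bullet> (B *v v) \<le> v \<bullet> (C *v v)"
  shows "neg_index C \<le> neg_index B"
proof -
  obtain S where S: "subspace S" "negative_on C S" "dim S = neg_index C"
    by (rule neg_index_attained)
  have "negative_on B S"
    using S(2) assms unfolding negative_on_def by (meson le_less_trans)
  with S dim_le_neg_index show ?thesis by metis
qed

text \<open>Interlacing: cutting an optimal subspace for \<open>B\<close> with the hyperplane of
  vectors whose \<open>i\<close>-th coordinate vanishes costs at most one dimension, and what
  remains is negative for \<open>C\<close>.\<close>

lemma neg_index_rank_one: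
  assumes "\<And>v. v $ i = 0 \<Longrightarrow> v \<bullet> (C *v v) \<le> v \<bullet> (B *v v)"
  shows "neg_index B \<le> neg_index C + 1"
proof -
  obtain S where S: "subspace S" "negative_on B S" "dim S = neg_index B"
    by (rule neg_index_attained)
  let ?H = "{v :: real^'a. axis i 1 \<bullet> v = 0}"
  have H: "subspace ?H" "dim ?H = DIM(real^'a) - 1"
    by (simp_all add: subspace_hyperplane dim_hyperplane axis_eq_0_iff)
  have "dim {x + y |x y. x \<in> S \<and> y \<in> ?H} + dim (S \<inter> ?H) = dim S + dim ?H"
    by (rule dim_sums_Int[OF S(1) H(1)])
  moreover have "dim {x + y |x y. x \<in> S \<and> y \<in> ?H} \<le> DIM(real^'a)"
    by (rule dim_subset_UNIV)
  ultimately have "dim S \<le> dim (S \<inter> ?H) + 1" using H(2) by linarith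
  moreover have "negative_on C (S \<inter> ?H)"
    using S(2) assms unfolding negative_on_def by (fastforce simp: inner_axis')
  then have "dim (S \<inter> ?H) \<le> neg_index C"
    by (intro dim_le_neg_index subspace_inter S H)
  ultimately show ?thesis using S(3) by linarith
qed

section \<open>Lower semicontinuity and measurability of the index\<close>

text \<open>Homogeneity reduces negativity to the compact unit sphere of \<open>S\<close>. The
  matrices that fail there form the projection of a closed set along a compact factor, which is
  closed.\<close>

lemma open_negative_on:
  fixes S :: "(real^'n) set"
  assumes "subspace S"
  shows "open {B. negative_on B S}"
proof -
  let ?K = "S \<inter> sphere 0 1"
  have K: "compact ?K"
    using closed_subspace[OF assms] by (simp add: closed_Int_compact[OF _ compact_sphere])
  have eq: "negative_on B S \<longleftrightarrow> (\<forall>v\<in>?K. v \<bullet> (B *v v) < 0)" for B :: "real^'n^'n"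
  proof
    assume r: "\<forall>v\<in>?K. v \<bullet> (B *v v) < 0"
    show "negative_on B S" unfolding negative_on_def
    proof (intro ballI impI)
      fix v assume v: "v \<in> S" "v \<noteq> 0"
      let ?u = "v /\<^sub>R norm v"
      have "?u \<in> ?K" using v assms by (simp add: subspace_scale)
      then have "?u \<bullet> (B *v ?u) < 0" using r by blast
      then have "(inverse (norm v))\<^sup>2 * (v \<bullet> (B *v v)) < 0"
        by (simp add: matrix_vector_mult_scaleR power2_eq_square)
      then show "v \<bullet> (B *v v) < 0" by (simp add: mult_less_0_iff not_less[symmetric])
    qed
  qed (auto simp: negative_on_def)
  have "closed {(v :: real^'n, B :: real^'n^'n). 0 \<le> v \<bullet> (B *v v)}"
    unfolding matrix_vector_mult_def inner_vec_def case_prod_unfold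
    by (intro closed_Collect_le continuous_intros continuous_on_component)
  from closed_compact_projection[OF K this]
  have "open (- {B :: real^'n^'n. \<exists>v. v \<in> ?K \<and> 0 \<le> v \<bullet> (B *v v)})" by (simp add: open_Compl)
  moreover have "- {B :: real^'n^'n. \<exists>v. v \<in> ?K \<and> 0 \<le> v \<bullet> (B *v v)} = {B. negative_on B S}"
    unfolding eq using not_le by blast
  ultimately show ?thesis by simp
qed

text \<open>Lower semicontinuity: an optimal subspace for one matrix remains negative for all nearby
  matrices. Borel measurability of the index follows from this.\<close>

lemma open_neg_index_ge: "open {B :: real^'n^'n. k \<le> neg_index B}"
proof -
  have "{B :: real^'n^'n. k \<le> neg_index B} =
      (\<Union>S\<in>{S. subspace S \<and> k \<le> dim S}. {B. negative_on B S})" (is "?L = ?R")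
  proof (intro set_eqI iffI)
    fix B assume "B \<in> ?L"
    then show "B \<in> ?R"
      using neg_index_attained[of B] by (metis (mono_tags, lifting) UN_I mem_Collect_eq)
  next
    fix B assume "B \<in> ?R"
    then show "B \<in> ?L"
      using dim_le_neg_index le_trans by blast
  qed
  then show ?thesis by (auto intro!: open_negative_on)
qed

lemma measurable_neg_index: "neg_index \<in> borel \<rightarrow>\<^sub>M count_space UNIV"
proof -
  have "neg_index -` {..<k} \<in> sets (borel :: (real^'a^'a) measure)" for k
  proof -
    have "neg_index -` {..<k} = - {B :: real^'a^'a. k \<le> neg_index B}" by auto
    then show ?thesis using borel_open[OF open_neg_index_ge] by (auto intro!: borel_comp)
  qed
  moreover have "neg_index -` {k} = neg_index -` {..<Suc k} - neg_index -` {..<k}" for k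
    by auto
  ultimately have "neg_index -` {k} \<in> sets (borel :: (real^'a^'a) measure)" for k
    by (metis sets.Diff)
  then show ?thesis
    by (intro measurable_count_space_eq2_countable[THEN iffD2]) auto
qed

lemma sets_neg_index_neq:
  fixes f g :: "'b \<Rightarrow> real^'n^'n"
  assumes [measurable]: "f \<in> borel_measurable N" "g \<in> borel_measurable N"
  shows "{x \<in> space N. neg_index (f x) \<noteq> neg_index (g x)} \<in> sets N"
proof -
  have "(\<lambda>B. real (neg_index (B :: real^'n^'n))) \<in> borel_measurable borel"
    by (rule measurable_compose[OF measurable_neg_index]) simp
  from measurable_compose[OF assms(1) this] measurable_compose[OF assms(2) this]
  have "{x \<in> space N. real (neg_index (f x)) \<noteq> real (neg_index (g x))} \<in> sets N"
    by (rule borel_measurable_neq)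
  then show ?thesis by simp
qed

section \<open>Eigenvalues close to zero\<close>

text \<open>An optimal subspace for the upper shift cannot contain the eigenvector \<open>w\<close>,
  at which that form is nonnegative. Adjoining \<open>w\<close> gives a subspace of one dimension
  more that is negative for the lower shift.\<close>

lemma neg_index_eigenvalue:
  assumes "\<And>u v. u \<bullet> (A *v v) = v \<bullet> (A *v u)" and w: "A *v w = \<mu> *\<^sub>R w" "w \<noteq> 0"
    and \<mu>: "\<bar>\<mu>\<bar> < \<epsilon>"
  shows "neg_index (A + \<epsilon> *\<^sub>R mat 1) < neg_index (A - \<epsilon> *\<^sub>R mat 1)"
proof -
  obtain S where S: "subspace S" "negative_on (A + \<epsilon> *\<^sub>R mat 1) S" "dim S = neg_index (A + \<epsilon> *\<^sub>R mat 1)"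
    by (rule neg_index_attained)
  have neg: "s \<bullet> (A *v s) + \<epsilon> * (s \<bullet> s) < 0" if "s \<in> S" "s \<noteq> 0" for s
    using S(2) that by (simp add: negative_on_def algebra_simps scaleR_matrix_vector_assoc[symmetric] inner_add_right)
  have "w \<notin> S"
  proof
    assume "w \<in> S"
    from neg[OF this w(2)] have "(\<mu> + \<epsilon>) * (w \<bullet> w) < 0" by (simp add: w algebra_simps)
    moreover have "(\<mu> + \<epsilon>) * (w \<bullet> w) \<ge> 0" using \<mu> by (intro mult_nonneg_nonneg) auto
    ultimately show False by simp
  qed
  then have "dim (span (insert w S)) = Suc (dim S)"
    using S(1) by (simp add: dim_insert span_eq_iff[THEN iffD2])
  moreover have "negative_on (A - \<epsilon> *\<^sub>R mat 1) (span (insert w S))"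
    unfolding negative_on_def
  proof (intro ballI impI)
    fix v assume "v \<in> span (insert w S)" and v: "v \<noteq> 0"
    then obtain c where "v - c *\<^sub>R w \<in> span S" by (auto simp: span_insert)
    then obtain s where s: "s \<in> S" "v = s + c *\<^sub>R w"
      using S(1) by (metis diff_add_cancel span_eq_iff)
    have ws: "w \<bullet> (A *v s) = \<mu> * (s \<bullet> w)" using assms(1)[of w s] w by simp
    \<comment> \<open>Split \<open>A - \<epsilon> I\<close> as
      \<open>(A - \<mu> I) - (\<epsilon> - \<mu>) I\<close>. As \<open>A\<close> is symmetric and
      \<open>w\<close> lies in the kernel of \<open>A - \<mu> I\<close>, the form of the first part
      takes the same value at \<open>v\<close> as at \<open>s\<close>.\<close>
    have "v \<bullet> ((A - \<epsilon> *\<^sub>R mat 1) *v v) = (s \<bullet> (A *v s) - \<mu> * (s \<bullet> s)) - (\<epsilon> - \<mu>) * (v \<bullet> v)"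
      unfolding s(2)
      by (simp add: matrix_vector_right_distrib matrix_vector_mult_diff_rdistrib matrix_vector_mult_scaleR
          scaleR_matrix_vector_assoc[symmetric] w ws inner_add_left inner_add_right inner_diff_right algebra_simps inner_commute[of w s])
    \<comment> \<open>By \<open>- \<mu> \<le> \<epsilon>\<close> this is at most the form of the
      upper shift, which is negative on \<open>S\<close>.\<close>
    moreover have "s \<bullet> (A *v s) - \<mu> * (s \<bullet> s) \<le> 0"
    proof (cases "s = 0")
      case False
      have "- \<mu> * (s \<bullet> s) \<le> \<epsilon> * (s \<bullet> s)" using \<mu> by (intro mult_right_mono) auto
      with neg[OF s(1) False] show ?thesis by simp
    qed simp
    moreover have "(\<epsilon> - \<mu>) * (v \<bullet> v) > 0" using v \<mu> by (intro mult_pos_pos) auto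
    ultimately show "v \<bullet> ((A - \<epsilon> *\<^sub>R mat 1) *v v) < 0" by linarith
  qed
  ultimately show ?thesis
    using dim_le_neg_index[OF subspace_span, of "A - \<epsilon> *\<^sub>R mat 1" "insert w S"] S(3) by simp
qed

text \<open>A minimiser \<open>w\<close> of \<open>norm (A *v v)\<close> on the unit sphere
  satisfies \<open>A (A w) = m^2 w\<close>, where \<open>m\<close> is the minimum. Then
  \<open>(A - m I) (A + m I) w = 0\<close> makes either \<open>w\<close> or \<open>A w + m w\<close>
  an eigenvector, for \<open>- m\<close> or \<open>m\<close> respectively.\<close>

lemma symmetric_least_eigenvalue:
  fixes A :: "real^'n^'n"
  assumes sym: "\<And>u v. u \<bullet> (A *v v) = v \<bullet> (A *v u)"
  obtains w \<mu> where "w \<noteq> 0" "A *v w = \<mu> *\<^sub>R w" "\<And>v. \<bar>\<mu>\<bar> * norm v \<le> norm (A *v v)"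
proof -
  have "continuous_on (sphere 0 1) (\<lambda>v. norm (A *v v))" by (intro continuous_intros)
  from continuous_attains_inf[OF compact_sphere _ this]
  obtain w where w: "norm w = 1" and min: "\<And>v. norm v = 1 \<Longrightarrow> norm (A *v w) \<le> norm (A *v v)"
    by (auto simp: dist_norm)
  define m where "m = norm (A *v w)"
  have le: "m * norm v \<le> norm (A *v v)" for v
  proof (cases "v = 0")
    case False
    then have "m \<le> norm (A *v (v /\<^sub>R norm v))" unfolding m_def by (intro min) simp
    also have "\<dots> = norm (A *v v) / norm v" by (simp add: matrix_vector_mult_scaleR divide_inverse_commute)
    finally show ?thesis using False by (simp add: field_simps)
  qed simp
  have m0: "m \<ge> 0" by (simp add: m_def)
  let ?r = "A *v (A *v w) - m\<^sup>2 *\<^sub>R w"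
  \<comment> \<open>First-order optimality of \<open>w\<close> for the nonnegative form \<open>\<parallel>A v\<parallel>\<^sup>2 - m\<^sup>2 \<parallel>v\<parallel>\<^sup>2\<close>, tested in the direction \<open>?r\<close>.\<close>
  have "?r = 0"
  proof (rule ccontr)
    assume r: "?r \<noteq> 0"
    define Q where "Q v = (norm (A *v v))\<^sup>2 - m\<^sup>2 * (norm v)\<^sup>2" for v
    have Q0: "Q v \<ge> 0" for v
      using power_mono[OF le[of v], of 2] m0 by (simp add: Q_def power_mult_distrib)
    have exp: "Q (w + t *\<^sub>R v) = Q w + 2 * t * (v \<bullet> ?r) + t\<^sup>2 * Q v" for t v
    proof -
      have "(A *v w) \<bullet> (A *v v) = v \<bullet> (A *v (A *v w))" using sym[of "A *v w" v] by simp
      then show ?thesis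
        unfolding Q_def power2_norm_eq_inner
        by (simp add: matrix_vector_right_distrib matrix_vector_mult_scaleR inner_add_left inner_add_right
            inner_diff_right algebra_simps power2_eq_square inner_commute)
    qed
    have Qw: "Q w = 0" by (simp add: Q_def w m_def)
    define b where "b = ?r \<bullet> ?r"
    have b: "b > 0" using r by (simp add: b_def)
    \<comment> \<open>\<open>Q\<close> at the perturbed point factors as
      \<open>t * (2 * b + t * Q ?r)\<close>, so it is negative once \<open>t < 0\<close> is small
      enough to keep the second factor positive. The added 1 guards against
      \<open>Q ?r = 0\<close>.\<close>
    define t where "t = - b / (Q ?r + 1)"
    have pos: "Q ?r + 1 > 0" using Q0[of ?r] by linarith
    have "Q (w + t *\<^sub>R ?r) = t * (2 * b + t * Q ?r)"
      unfolding exp Qw by (simp add: b_def power2_eq_square algebra_simps)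
    also have "\<dots> < 0"
    proof -
      have "t < 0" using b pos by (simp add: t_def)
      moreover have "2 * b + t * Q ?r = b * (Q ?r + 2) / (Q ?r + 1)"
        using pos by (simp add: t_def field_simps)
      then have "2 * b + t * Q ?r > 0" using b Q0[of ?r] pos by (simp add: zero_less_mult_iff)
      ultimately show ?thesis by (simp add: mult_less_0_iff)
    qed
    finally show False using Q0 by (meson not_less)
  qed
  then have AA: "A *v (A *v w) = m\<^sup>2 *\<^sub>R w" by simp
  show thesis
  proof (cases "A *v w + m *\<^sub>R w = 0")
    case True
    show thesis
    proof (rule that[of w "- m"])
      show "w \<noteq> 0" using w by auto
      show "A *v w = (- m) *\<^sub>R w" using True by (simp add: eq_neg_iff_add_eq_0)
    qed (use le m0 in auto)
  next
    case False
    show thesis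
    proof (rule that[OF False])
      show "A *v (A *v w + m *\<^sub>R w) = m *\<^sub>R (A *v w + m *\<^sub>R w)"
        by (simp add: matrix_vector_right_distrib matrix_vector_mult_scaleR AA power2_eq_square algebra_simps)
    qed (use le m0 in auto)
  qed
qed

text \<open>If the eigenvalue of least modulus exceeded \<open>s / x\<close> in modulus,
  \<open>A\<close> would be invertible with inverse of norm at most
  \<open>1 / \<bar>\<mu>\<bar>\<close>, forcing \<open>cond_number A < x\<close>. A singular
  \<open>A\<close> has \<open>\<mu> = 0\<close>, so it is covered whatever value
  \<open>matrix_inv A\<close> takes.\<close>

lemma cond_number_eigenvalue:
  fixes A :: "real^'n^'n"
  assumes sym: "\<And>u v. u \<bullet> (A *v v) = v \<bullet> (A *v u)"
    and "op_norm A \<le> s" "0 < s" "0 < x" "x \<le> cond_number A"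
  obtains w \<mu> where "w \<noteq> 0" "A *v w = \<mu> *\<^sub>R w" "\<bar>\<mu>\<bar> \<le> s / x"
proof -
  obtain w \<mu> where w: "w \<noteq> 0" "A *v w = \<mu> *\<^sub>R w" and le: "\<And>v. \<bar>\<mu>\<bar> * norm v \<le> norm (A *v v)"
    using symmetric_least_eigenvalue[OF sym] by blast
  have "\<bar>\<mu>\<bar> \<le> s / x"
  proof (rule ccontr)
    assume "\<not> \<bar>\<mu>\<bar> \<le> s / x"
    then have l: "s / x < \<bar>\<mu>\<bar>" by simp
    moreover have "s / x > 0" using assms by simp
    ultimately have l0: "\<bar>\<mu>\<bar> > 0" by linarith
    have "v = 0" if "A *v v = 0" for v
      using le[of v] that l0 by (simp add: mult_le_0_iff)
    then have "invertible A"
      by (auto simp: invertible_left_inverse matrix_left_invertible_ker)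
    then have inv: "A ** matrix_inv A = mat 1"
      unfolding invertible_def matrix_inv_def by (rule someI2_ex) simp
    have "op_norm (matrix_inv A) \<le> 1 / \<bar>\<mu>\<bar>"
      unfolding op_norm_def
    proof (rule onorm_le)
      fix v
      have "A *v (matrix_inv A *v v) = v" by (simp add: matrix_vector_mul_assoc inv)
      with le[of "matrix_inv A *v v"] l0
      show "norm (matrix_inv A *v v) \<le> 1 / \<bar>\<mu>\<bar> * norm v" by (simp add: field_simps)
    qed
    moreover have "0 \<le> op_norm (matrix_inv A)"
      unfolding op_norm_def by (intro onorm_pos_le matrix_vector_mul_bounded_linear)
    ultimately have "cond_number A \<le> s * (1 / \<bar>\<mu>\<bar>)"
      unfolding cond_number_def using assms by (intro mult_mono) auto
    also have "\<dots> < x" using l l0 assms by (simp add: field_simps)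
    finally show False using assms by simp
  qed
  with w that show thesis by blast
qed

section \<open>Gaussian estimates\<close>

lemma normal_density_le: "0 < \<sigma> \<Longrightarrow> normal_density \<mu> \<sigma> x \<le> 1 / (\<sigma> * sqrt (2 * pi))"
  by (simp add: normal_density_def real_sqrt_mult field_simps)

text \<open>The diameter condition traps \<open>S\<close> in an interval of length
  \<open>\<delta>\<close> starting at its infimum, and the density is at most its peak value. The
  condition is on pairs of points because \<open>neg_index_jump_diameter\<close> delivers it in that
  form.\<close>

lemma (in prob_space) normal_small_diameter:
  assumes g: "distributed M lborel g (normal_density 0 \<sigma>)" and \<sigma>: "0 < \<sigma>"
    and S: "S \<in> sets borel" and \<delta>: "0 \<le> \<delta>"
    and diam: "\<And>u v. u \<in> S \<Longrightarrow> v \<in> S \<Longrightarrow> v \<le> u + \<delta>"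
  shows "prob (g -` S \<inter> space M) \<le> \<delta> / (\<sigma> * sqrt (2 * pi))"
proof (cases "S = {}")
  case False
  then obtain v where v: "v \<in> S" by blast
  have bdd: "bdd_below S" using diam[OF _ v] by (intro bdd_belowI[of _ "v - \<delta>"]) (simp add: algebra_simps)
  have sub: "S \<subseteq> {Inf S..Inf S + \<delta>}"
  proof
    fix u assume u: "u \<in> S"
    have "u - \<delta> \<le> Inf S" using diam[OF _ u] False by (intro cInf_greatest) (auto simp: algebra_simps)
    with cInf_lower[OF u bdd] show "u \<in> {Inf S..Inf S + \<delta>}" by auto
  qed
  have "emeasure M (g -` S \<inter> space M) = (\<integral>\<^sup>+u. ennreal (normal_density 0 \<sigma> u) * indicator S u \<partial>lborel)"
    using S by (intro distributed_emeasure[OF g]) simp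
  also have "\<dots> \<le> (\<integral>\<^sup>+u. ennreal (1 / (\<sigma> * sqrt (2 * pi))) * indicator {Inf S..Inf S + \<delta>} u \<partial>lborel)"
    using sub normal_density_le[OF \<sigma>] by (intro nn_integral_mono) (auto simp: indicator_def intro!: ennreal_leI)
  also have "\<dots> = ennreal (1 / (\<sigma> * sqrt (2 * pi)) * \<delta>)"
    using \<delta> \<sigma> by (simp add: nn_integral_cmult ennreal_mult[symmetric])
  finally show ?thesis
    using \<sigma> \<delta> by (simp add: emeasure_eq_measure)
qed (use assms in simp)

text \<open>From \<open>a^2 + (u - a)^2 \<le> u^2\<close> for \<open>u \<ge> a\<close>, the density
  beyond \<open>a\<close> is at most the exponential factor times the Gaussian density centred at
  \<open>a\<close>, whose total mass is 1.\<close>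

lemma (in prob_space) normal_upper_tail:
  assumes g: "distributed M lborel g (normal_density 0 \<sigma>)" and \<sigma>: "0 < \<sigma>" and a: "0 \<le> a"
  shows "prob (g -` {a..} \<inter> space M) \<le> exp (- a\<^sup>2 / (2 * \<sigma>\<^sup>2))"
proof -
  have le: "normal_density 0 \<sigma> u \<le> exp (- a\<^sup>2 / (2 * \<sigma>\<^sup>2)) * normal_density a \<sigma> u" if "a \<le> u" for u
  proof -
    have "a\<^sup>2 + (u - a)\<^sup>2 \<le> u\<^sup>2"
      using mult_nonneg_nonneg[OF a, of "u - a"] that by (simp add: power2_eq_square algebra_simps)
    then have "- u\<^sup>2 / (2 * \<sigma>\<^sup>2) \<le> - a\<^sup>2 / (2 * \<sigma>\<^sup>2) + - (u - a)\<^sup>2 / (2 * \<sigma>\<^sup>2)"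
      unfolding add_divide_distrib[symmetric] by (intro divide_right_mono) auto
    then have "exp (- u\<^sup>2 / (2 * \<sigma>\<^sup>2)) \<le> exp (- a\<^sup>2 / (2 * \<sigma>\<^sup>2)) * exp (- (u - a)\<^sup>2 / (2 * \<sigma>\<^sup>2))"
      by (simp add: exp_add[symmetric])
    then show ?thesis unfolding normal_density_def
      by (simp add: mult.left_commute divide_right_mono)
  qed
  have "emeasure M (g -` {a..} \<inter> space M) = (\<integral>\<^sup>+u. ennreal (normal_density 0 \<sigma> u) * indicator {a..} u \<partial>lborel)"
    by (intro distributed_emeasure[OF g]) simp
  also have "\<dots> \<le> (\<integral>\<^sup>+u. ennreal (exp (- a\<^sup>2 / (2 * \<sigma>\<^sup>2))) * ennreal (normal_density a \<sigma> u) \<partial>lborel)"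
    using le by (intro nn_integral_mono) (auto simp: indicator_def ennreal_mult[symmetric] intro!: ennreal_leI)
  also have "\<dots> = ennreal (exp (- a\<^sup>2 / (2 * \<sigma>\<^sup>2))) * emeasure (density lborel (normal_density a \<sigma>)) UNIV"
    by (simp add: nn_integral_cmult emeasure_density)
  also have "\<dots> = ennreal (exp (- a\<^sup>2 / (2 * \<sigma>\<^sup>2)))"
    using prob_space.emeasure_space_1[OF prob_space_normal_density[OF \<sigma>, of a]] by simp
  finally show ?thesis by (simp add: emeasure_eq_measure)
qed

lemma (in prob_space) normal_abs_tail:
  assumes g: "distributed M lborel g (normal_density 0 \<sigma>)" and \<sigma>: "0 < \<sigma>" and a: "0 \<le> a"
  shows "prob {\<omega> \<in> space M. a \<le> \<bar>g \<omega>\<bar>} \<le> 2 * exp (- a\<^sup>2 / (2 * \<sigma>\<^sup>2))"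
proof -
  have [measurable]: "g \<in> borel_measurable M" using distributed_measurable[OF g] by simp
  have m: "distributed M lborel (\<lambda>\<omega>. - g \<omega>) (normal_density 0 \<sigma>)"
    using normal_density_affine[OF g \<sigma>, of "-1" 0] by simp
  have "{\<omega> \<in> space M. a \<le> \<bar>g \<omega>\<bar>} = (g -` {a..} \<inter> space M) \<union> ((\<lambda>\<omega>. - g \<omega>) -` {a..} \<inter> space M)"
    by (auto simp: abs_real_def)
  then have "prob {\<omega> \<in> space M. a \<le> \<bar>g \<omega>\<bar>} \<le> prob (g -` {a..} \<inter> space M) + prob ((\<lambda>\<omega>. - g \<omega>) -` {a..} \<inter> space M)"
    by (simp add: measure_Un_le)
  with normal_upper_tail[OF g \<sigma> a] normal_upper_tail[OF m \<sigma> a] show ?thesis by linarith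
qed

text \<open>Freezing the independent variable \<open>X\<close>: the joint law is a product, so by
  Fubini a bound uniform over the fixed values of \<open>X\<close> survives averaging.\<close>

lemma (in prob_space) indep_var_prob_le:
  assumes ind: "indep_var S X N Y" and E: "E \<in> sets (S \<Otimes>\<^sub>M N)" and c: "0 \<le> c"
    and le: "\<And>a. a \<in> space S \<Longrightarrow> prob {\<omega> \<in> space M. (a, Y \<omega>) \<in> E} \<le> c"
  shows "prob {\<omega> \<in> space M. (X \<omega>, Y \<omega>) \<in> E} \<le> c"
proof -
  from ind have X[measurable]: "X \<in> M \<rightarrow>\<^sub>M S" and Y[measurable]: "Y \<in> M \<rightarrow>\<^sub>M N"
    and eq: "distr M S X \<Otimes>\<^sub>M distr M N Y = distr M (S \<Otimes>\<^sub>M N) (\<lambda>\<omega>. (X \<omega>, Y \<omega>))"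
    by (auto simp: indep_var_distribution_eq)
  interpret X: prob_space "distr M S X" by (rule prob_space_distr[OF X])
  interpret Y: prob_space "distr M N Y" by (rule prob_space_distr[OF Y])
  have "emeasure M {\<omega> \<in> space M. (X \<omega>, Y \<omega>) \<in> E} = emeasure (distr M (S \<Otimes>\<^sub>M N) (\<lambda>\<omega>. (X \<omega>, Y \<omega>))) E"
    using E by (subst emeasure_distr) (auto intro!: arg_cong[where f="emeasure M"])
  also have "\<dots> = (\<integral>\<^sup>+a. emeasure (distr M N Y) (Pair a -` E) \<partial>distr M S X)"
    unfolding eq[symmetric] using E by (intro Y.emeasure_pair_measure_alt) simp
  also have "\<dots> \<le> (\<integral>\<^sup>+a. ennreal c \<partial>distr M S X)"
  proof (rule nn_integral_mono)
    fix a assume "a \<in> space (distr M S X)"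
    then have a: "a \<in> space S" by simp
    have "emeasure (distr M N Y) (Pair a -` E) = emeasure M {\<omega> \<in> space M. (a, Y \<omega>) \<in> E}"
      using sets_Pair1[OF E] by (subst emeasure_distr) (auto intro!: arg_cong[where f="emeasure M"])
    also have "\<dots> \<le> ennreal c" unfolding emeasure_eq_measure by (intro ennreal_leI le a)
    finally show "emeasure (distr M N Y) (Pair a -` E) \<le> ennreal c" .
  qed
  also have "\<dots> = ennreal c" using X.emeasure_space_1 by simp
  finally show ?thesis using c by (simp add: emeasure_eq_measure)
qed

section \<open>A Wegner estimate\<close>

text \<open>The matrix unit \<open>e_i e_i^T\<close>, whose quadratic form is the square of the
  \<open>i\<close>-th coordinate.\<close>

abbreviation diag_unit :: "'n \<Rightarrow> real^'n^'n" where
  "diag_unit i \<equiv> axis i (axis i 1)"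

lemma inner_diag_unit: "v \<bullet> (diag_unit i *v v) = (v $ i)\<^sup>2"
  for v :: "real^'n"
proof -
  have "diag_unit i *v v = axis i (v $ i)"
    by (auto simp: vec_eq_iff matrix_vector_mult_def axis_def if_distrib[of "\<lambda>x. x * _"] cong: if_cong)
  then show ?thesis by (simp add: inner_axis power2_eq_square)
qed

lemma mat_1_eq_sum_diag_unit: "mat 1 = (\<Sum>i\<in>UNIV. diag_unit (i :: 'n::finite))"
  by (auto simp: vec_eq_iff mat_def axis_def if_distrib[of "\<lambda>x. x $ _"] cong: if_cong)

lemma diagonal_matrix_eq_sum:
  fixes G :: "real^'n^'n"
  assumes "diagonal_matrix G"
  shows "G = (\<Sum>i\<in>UNIV. G $ i $ i *\<^sub>R diag_unit i)"
  using assms by (auto simp: diagonal_matrix_def vec_eq_iff axis_def if_distrib[of "\<lambda>x. x $ _"]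
      if_distrib[of "\<lambda>x. _ * x"] cong: if_cong)

text \<open>Along \<open>B + t * diag_unit i\<close> the index decreases in \<open>t\<close>, and
  any two of its values differ by at most one. Two disjoint windows of length
  \<open>\<delta>\<close>, each containing a drop, would add up to a drop of two.\<close>

lemma neg_index_jump_diameter:
  fixes B :: "real^'n^'n"
  assumes \<delta>: "0 \<le> \<delta>"
    and u: "neg_index (B + u *\<^sub>R diag_unit i) \<noteq> neg_index (B + (u + \<delta>) *\<^sub>R diag_unit i)"
    and v: "neg_index (B + v *\<^sub>R diag_unit i) \<noteq> neg_index (B + (v + \<delta>) *\<^sub>R diag_unit i)"
  shows "v \<le> u + \<delta>"
proof (rule ccontr)
  define f where "f t = neg_index (B + t *\<^sub>R diag_unit i)" for t
  have q: "w \<bullet> ((B + t *\<^sub>R diag_unit i) *v w) = w \<bullet> (B *v w) + t * (w $ i)\<^sup>2" for w t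
    by (simp add: matrix_vector_mult_add_rdistrib scaleR_matrix_vector_assoc[symmetric] inner_add_right inner_diag_unit)
  have anti: "f t \<le> f s" if "s \<le> t" for s t
    unfolding f_def by (rule neg_index_antimono) (simp add: q that mult_right_mono)
  have one: "f s \<le> f t + 1" for s t
    unfolding f_def by (rule neg_index_rank_one[of i]) (simp add: q)
  assume "\<not> v \<le> u + \<delta>"
  then have "f v \<le> f (u + \<delta>)" by (intro anti) simp
  moreover have "f (u + \<delta>) < f u" "f (v + \<delta>) < f v"
    using u v anti[of u "u + \<delta>"] anti[of v "v + \<delta>"] \<delta> by (auto simp: f_def)
  ultimately show False using one[of u "v + \<delta>"] by linarith
qed

lemma (in prob_space) neg_index_coordinate_jump:
  fixes K :: "real^'n^'n" and g :: "'n \<Rightarrow> 'a \<Rightarrow> real"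
  assumes g: "indep_gaussians M \<sigma> g UNIV" and \<sigma>: "0 < \<sigma>" and \<delta>: "0 \<le> \<delta>"
  shows "prob {\<omega> \<in> space M. neg_index (K + (\<Sum>j\<in>UNIV. g j \<omega> *\<^sub>R diag_unit j)) \<noteq>
      neg_index (K + (\<Sum>j\<in>UNIV. g j \<omega> *\<^sub>R diag_unit j) + \<delta> *\<^sub>R diag_unit i)}
    \<le> \<delta> / (\<sigma> * sqrt (2 * pi))"
proof -
  define R where "R h = K + (\<Sum>j\<in>UNIV - {i}. h j *\<^sub>R diag_unit j)" for h :: "'n \<Rightarrow> real"
  define E where "E = {(h, u). neg_index (R h + u i *\<^sub>R diag_unit i) \<noteq> neg_index (R h + (u i + \<delta>) *\<^sub>R diag_unit i)}
    \<inter> space (PiM (UNIV - {i}) (\<lambda>_. borel) \<Otimes>\<^sub>M PiM {i} (\<lambda>_. borel))"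
  have R[measurable]: "R \<in> borel_measurable (PiM (UNIV - {i}) (\<lambda>_. borel))"
    unfolding R_def by measurable
  have R_restrict: "R (restrict h (UNIV - {i})) = R h" for h
    unfolding R_def by (intro arg_cong2[where f="(+)"] sum.cong) auto
  have restrict_single: "restrict h {i} i = h i" for h :: "'n \<Rightarrow> real"
    by simp
  have E: "E \<in> sets (PiM (UNIV - {i}) (\<lambda>_. borel) \<Otimes>\<^sub>M PiM {i} (\<lambda>_. borel))"
  proof -
    have "(\<lambda>x. R (fst x) + snd x i *\<^sub>R diag_unit i) \<in> borel_measurable (PiM (UNIV - {i}) (\<lambda>_. borel) \<Otimes>\<^sub>M PiM {i} (\<lambda>_. borel))"
      "(\<lambda>x. R (fst x) + (snd x i + \<delta>) *\<^sub>R diag_unit i) \<in> borel_measurable (PiM (UNIV - {i}) (\<lambda>_. borel) \<Otimes>\<^sub>M PiM {i} (\<lambda>_. borel))"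
      by measurable
    from sets_neg_index_neq[OF this] show ?thesis
      unfolding E_def case_prod_unfold by (rule back_subst[of "\<lambda>X. X \<in> _"]) auto
  qed
  have gi: "distributed M lborel (g i) (normal_density 0 \<sigma>)"
    using g by (simp add: indep_gaussians_def)
  have "indep_var (PiM (UNIV - {i}) (\<lambda>_. borel)) (\<lambda>\<omega>. restrict (\<lambda>j. g j \<omega>) (UNIV - {i}))
      (PiM {i} (\<lambda>_. borel)) (\<lambda>\<omega>. restrict (\<lambda>j. g j \<omega>) {i})"
    using g by (intro indep_var_restrict) (auto simp: indep_gaussians_def)
  from this E have "prob {\<omega> \<in> space M. (restrict (\<lambda>j. g j \<omega>) (UNIV - {i}), restrict (\<lambda>j. g j \<omega>) {i}) \<in> E}
      \<le> \<delta> / (\<sigma> * sqrt (2 * pi))"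
  proof (rule indep_var_prob_le)
    fix h :: "'n \<Rightarrow> real" assume h: "h \<in> space (PiM (UNIV - {i}) (\<lambda>_. borel))"
    define S where "S = {u. neg_index (R h + u *\<^sub>R diag_unit i) \<noteq> neg_index (R h + (u + \<delta>) *\<^sub>R diag_unit i)}"
    have "(\<lambda>u. R h + u *\<^sub>R diag_unit i) \<in> borel_measurable borel"
      "(\<lambda>u. R h + (u + \<delta>) *\<^sub>R diag_unit i) \<in> borel_measurable borel"
      by measurable
    from sets_neg_index_neq[OF this] have S: "S \<in> sets borel" by (simp add: S_def)
    have "{\<omega> \<in> space M. (h, restrict (\<lambda>j. g j \<omega>) {i}) \<in> E} = g i -` S \<inter> space M"
      using h by (auto simp: E_def S_def space_pair_measure space_PiM)
    also have "prob \<dots> \<le> \<delta> / (\<sigma> * sqrt (2 * pi))"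
      by (rule normal_small_diameter[OF gi \<sigma> S \<delta>]) (use neg_index_jump_diameter[OF \<delta>] in \<open>simp add: S_def\<close>)
    finally show "prob {\<omega> \<in> space M. (h, restrict (\<lambda>j. g j \<omega>) {i}) \<in> E} \<le> \<delta> / (\<sigma> * sqrt (2 * pi))" .
  qed (use \<sigma> \<delta> in simp)
  also have "{\<omega> \<in> space M. (restrict (\<lambda>j. g j \<omega>) (UNIV - {i}), restrict (\<lambda>j. g j \<omega>) {i}) \<in> E} =
     {\<omega> \<in> space M. neg_index (K + (\<Sum>j\<in>UNIV. g j \<omega> *\<^sub>R diag_unit j)) \<noteq>
      neg_index (K + (\<Sum>j\<in>UNIV. g j \<omega> *\<^sub>R diag_unit j) + \<delta> *\<^sub>R diag_unit i)}"
    unfolding E_def using R_restrict restrict_single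
    by (auto simp: R_def space_pair_measure space_PiM sum.remove[of UNIV i] algebra_simps simp del: restrict_apply)
  finally show ?thesis .
qed

text \<open>Conditioning on \<open>X\<close> fixes \<open>F (X \<omega>)\<close>. The shift by
  \<open>\<delta> I\<close> is made one diagonal position at a time, each costing the probability in
  \<open>neg_index_coordinate_jump\<close>, and a union bound adds the costs.\<close>

lemma (in prob_space) neg_index_shift:
  fixes X G :: "'a \<Rightarrow> real^'n^'n"
  assumes ind: "indep_var borel X borel G"
    and G: "\<And>\<omega>. \<omega> \<in> space M \<Longrightarrow> diagonal_matrix (G \<omega>)"
    and g: "indep_gaussians M \<sigma> (\<lambda>i \<omega>. G \<omega> $ i $ i) UNIV"
    and \<sigma>: "0 < \<sigma>" and \<delta>: "0 \<le> \<delta>"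
    and F[measurable]: "F \<in> borel_measurable borel"
  shows "prob {\<omega> \<in> space M. neg_index (F (X \<omega>) + G \<omega>) \<noteq> neg_index (F (X \<omega>) + G \<omega> + \<delta> *\<^sub>R mat 1)}
    \<le> real CARD('n) * (\<delta> / (\<sigma> * sqrt (2 * pi)))"
proof -
  have [measurable]: "X \<in> borel_measurable M" "G \<in> borel_measurable M"
    using ind by (auto simp: indep_var_distribution_eq)
  \<comment> \<open>The matrix once the diagonal positions in \<open>J\<close> have been shifted;
    \<open>J\<close> grows from \<open>{}\<close> to \<open>UNIV\<close>.\<close>
  define H where "H J \<omega> = F (X \<omega>) + G \<omega> + (\<Sum>j\<in>J. \<delta> *\<^sub>R diag_unit j)" for J \<omega>
  have [measurable]: "H J \<in> borel_measurable M" for J unfolding H_def by measurable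
  let ?c = "\<delta> / (\<sigma> * sqrt (2 * pi))"
  have step: "prob {\<omega> \<in> space M. neg_index (H J \<omega>) \<noteq> neg_index (H J \<omega> + \<delta> *\<^sub>R diag_unit i)} \<le> ?c" for J i
  proof -
    let ?D = "\<Sum>j\<in>J. \<delta> *\<^sub>R diag_unit j :: real^'n^'n"
    let ?E = "{(K :: real^'n^'n, L :: real^'n^'n). neg_index (F K + L + ?D) \<noteq> neg_index (F K + L + ?D + \<delta> *\<^sub>R diag_unit i)}"
    have "?E \<in> sets (borel \<Otimes>\<^sub>M borel)"
    proof -
      have "(\<lambda>x. F (fst x) + snd x + ?D) \<in> borel_measurable (borel \<Otimes>\<^sub>M borel)"
        "(\<lambda>x. F (fst x) + snd x + ?D + \<delta> *\<^sub>R diag_unit i) \<in> borel_measurable (borel \<Otimes>\<^sub>M borel)"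
        by measurable
      from sets_neg_index_neq[OF this] show ?thesis
        by (simp add: space_pair_measure case_prod_unfold)
    qed
    with ind have "prob {\<omega> \<in> space M. (X \<omega>, G \<omega>) \<in> ?E} \<le> ?c"
    proof (rule indep_var_prob_le)
      fix K :: "real^'n^'n"
      have "{\<omega> \<in> space M. (K, G \<omega>) \<in> ?E} = {\<omega> \<in> space M.
          neg_index (F K + ?D + (\<Sum>j\<in>UNIV. G \<omega> $ j $ j *\<^sub>R diag_unit j)) \<noteq>
          neg_index (F K + ?D + (\<Sum>j\<in>UNIV. G \<omega> $ j $ j *\<^sub>R diag_unit j) + \<delta> *\<^sub>R diag_unit i)}"
        using diagonal_matrix_eq_sum[OF G] by (auto simp: add_ac)
      then show "prob {\<omega> \<in> space M. (K, G \<omega>) \<in> ?E} \<le> ?c"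
        using neg_index_coordinate_jump[OF g \<sigma> \<delta>] by simp
    qed (use \<sigma> \<delta> in simp)
    then show ?thesis by (simp add: H_def)
  qed
  have "prob {\<omega> \<in> space M. neg_index (H {} \<omega>) \<noteq> neg_index (H J \<omega>)} \<le> real (card J) * ?c"
    if "finite J" for J :: "'n set"
    using that
  proof induction
    case (insert i J)
    have H: "H (insert i J) \<omega> = H J \<omega> + \<delta> *\<^sub>R diag_unit i" for \<omega>
      using insert by (simp add: H_def algebra_simps)
    have "prob {\<omega> \<in> space M. neg_index (H {} \<omega>) \<noteq> neg_index (H (insert i J) \<omega>)} \<le>
        prob ({\<omega> \<in> space M. neg_index (H {} \<omega>) \<noteq> neg_index (H J \<omega>)} \<union>
         {\<omega> \<in> space M. neg_index (H J \<omega>) \<noteq> neg_index (H J \<omega> + \<delta> *\<^sub>R diag_unit i)})"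
      unfolding H by (intro finite_measure_mono sets.Un sets_neg_index_neq) auto
    also have "\<dots> \<le> prob {\<omega> \<in> space M. neg_index (H {} \<omega>) \<noteq> neg_index (H J \<omega>)} +
        prob {\<omega> \<in> space M. neg_index (H J \<omega>) \<noteq> neg_index (H J \<omega> + \<delta> *\<^sub>R diag_unit i)}"
      by (intro measure_Un_le sets_neg_index_neq) measurable
    also have "\<dots> \<le> real (card J) * ?c + ?c" by (intro add_mono insert.IH step)
    also have "\<dots> = real (card (insert i J)) * ?c"
      unfolding card_insert_disjoint[OF insert.hyps] of_nat_Suc distrib_right by linarith
    finally show ?case .
  qed simp
  from this[of UNIV] show ?thesis
    by (simp add: H_def scaleR_sum_right[symmetric] mat_1_eq_sum_diag_unit)
qed

section \<open>The condition number\<close>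

text \<open>In terms of \<open>r\<close>, \<open>L\<close> and \<open>c\<close> below, and up to the
  factor \<open>1 / (x * \<sigma>)\<close>, the right side is \<open>6 c r^7 + 2 c r^6 L\<close>,
  while the left side is at most \<open>(11/2) c r^7 + c r^6 L\<close>.\<close>

lemma final_numeric_bound:
  fixes n x \<sigma> :: real
  assumes n: "1 \<le> n" and \<sigma>: "0 < \<sigma>" "\<sigma> \<le> 1" and x: "1 \<le> x"
  shows "4 * n\<^sup>2 * exp (- (sqrt (2 * ln x + 2))\<^sup>2 / 2) +
      n * (2 * ((sqrt n + n\<^sup>2 * sqrt (2 * ln x + 2)) / x) / (\<sigma> * sqrt (2 * pi)))
    \<le> 6 * sqrt (2 / pi) * (n powr (7 / 2) / (x * \<sigma>)) * (1 + sqrt (2 * ln x / (9 * n)))"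
    (is "?lhs \<le> ?rhs")
proof -
  define r where "r = sqrt n"
  define L where "L = sqrt (2 * ln x)"
  define c where "c = sqrt (2 / pi)"
  have r: "r \<ge> 1" "n = r\<^sup>2" using n by (simp_all add: r_def)
  have L: "L \<ge> 0" using x by (simp add: L_def)
  \<comment> \<open>Expresses the tail term, which carries no \<open>sqrt (2 / pi)\<close>, in
    multiples of \<open>c\<close>; it amounts to \<open>pi \<le> 9 / 2\<close>.\<close>
  have c: "2 \<le> 3 * c"
  proof -
    have "(2 / 3)\<^sup>2 \<le> 2 / pi" using pi_less_4 pi_gt_zero by (simp add: field_simps power2_eq_square)
    then have "2 / 3 \<le> c" unfolding c_def by (rule real_le_rsqrt)
    then show ?thesis by simp
  qed
  have a: "sqrt (2 * ln x + 2) \<le> L + 3 / 2"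
  proof -
    have "sqrt (2 * ln x + 2) \<le> L + sqrt 2" unfolding L_def using x by (intro sqrt_add_le_add_sqrt) auto
    moreover have "sqrt 2 \<le> 3 / 2" by (intro real_le_lsqrt) (auto simp: power2_eq_square)
    ultimately show ?thesis by linarith
  qed
  \<comment> \<open>The logarithm under the root yields \<open>1 / x\<close>, and the summand 2
    yields \<open>exp (- 1)\<close>.\<close>
  have "exp (- (sqrt (2 * ln x + 2))\<^sup>2 / 2) = exp (- 1) / x"
  proof -
    have "- (sqrt (2 * ln x + 2))\<^sup>2 / 2 = - 1 - ln x" using x by (simp add: field_simps)
    then have "exp (- (sqrt (2 * ln x + 2))\<^sup>2 / 2) = exp (- 1 - ln x)" by (rule arg_cong)
    also have "\<dots> = exp (- 1) / x" using x by (simp add: exp_diff)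
    finally show ?thesis .
  qed
  moreover have "exp (- 1) \<le> (1 / 2 :: real)"
    using exp_ge_add_one_self[of "1 :: real"] by (simp add: exp_minus field_simps)
  ultimately have tail: "exp (- (sqrt (2 * ln x + 2))\<^sup>2 / 2) \<le> 1 / (2 * x)"
    using x by (simp add: field_simps)
  have c': "2 / sqrt (2 * pi) = c"
    by (simp add: c_def real_sqrt_mult real_sqrt_divide field_simps)
  have "?lhs \<le> 4 * n\<^sup>2 * (1 / (2 * x)) + n * (2 * ((sqrt n + n\<^sup>2 * (L + 3 / 2)) / x) / (\<sigma> * sqrt (2 * pi)))"
    using a tail n x \<sigma> by (intro add_mono mult_left_mono divide_right_mono) auto
  also have "\<dots> = (2 * r ^ 4 * \<sigma> + c * r\<^sup>2 * (r + r ^ 4 * (L + 3 / 2))) / (x * \<sigma>)"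
    unfolding c'[symmetric] r_def[symmetric] using x \<sigma> r
    by (simp add: field_simps power2_eq_square power4_eq_xxxx)
  also have "\<dots> \<le> (6 * c * r ^ 7 + 2 * c * r ^ 6 * L) / (x * \<sigma>)"
  proof (rule divide_right_mono)
    have p: "r ^ 3 \<le> r ^ 7" "r ^ 4 \<le> r ^ 7" "r ^ 6 \<le> r ^ 7" using r by (simp_all add: power_increasing)
    have c0: "c \<ge> 0" using c by simp
    have "2 * r ^ 4 * \<sigma> \<le> 2 * r ^ 4" using \<sigma> r by (simp add: mult_le_cancel_left1)
    also have "\<dots> \<le> 3 * c * r ^ 4" using c r by (intro mult_right_mono) auto
    also have "\<dots> \<le> 3 * c * r ^ 7" using p c0 by (intro mult_left_mono) auto
    finally have 1: "2 * r ^ 4 * \<sigma> \<le> 3 * c * r ^ 7" .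
    have "c * r\<^sup>2 * (r + r ^ 4 * (L + 3 / 2)) = c * r ^ 3 + c * r ^ 6 * L + 3 / 2 * (c * r ^ 6)"
      by (simp add: algebra_simps power_numeral_reduce power2_eq_square)
    moreover have "c * r ^ 3 \<le> c * r ^ 7" "c * r ^ 6 \<le> c * r ^ 7" using p c0 by (auto intro: mult_left_mono)
    moreover have "0 \<le> c * r ^ 6 * L" "0 \<le> c * r ^ 7" using c0 r L by auto
    ultimately show "2 * r ^ 4 * \<sigma> + c * r\<^sup>2 * (r + r ^ 4 * (L + 3 / 2)) \<le> 6 * c * r ^ 7 + 2 * c * r ^ 6 * L"
      using 1 by linarith
  qed (use x \<sigma> in simp)
  also have "\<dots> = ?rhs"
  proof -
    have "n powr (7 / 2) = r ^ 7"
      using r by (simp add: powr_powr powr_realpow flip: powr_numeral)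
    moreover have "sqrt (2 * ln x / (9 * n)) = L / (3 * r)"
      by (simp add: L_def r_def real_sqrt_mult real_sqrt_divide)
    ultimately show ?thesis
      using r x \<sigma> by (simp add: c_def field_simps power_numeral_reduce)
  qed
  finally show ?thesis .
qed

text \<open>Triangle inequality with the crude entrywise bound on the norm of the difference. After
  the factor \<open>n\<close> of the Wegner estimate its cost has order
  \<open>n^3 sqrt (ln x)\<close> for large \<open>x\<close>, that of the logarithmic term in the
  target.\<close>

lemma op_norm_perturbation:
  fixes A B :: "real^'n^'n"
  assumes "\<And>i j. \<bar>(A - B) $ i $ j\<bar> \<le> a"
  shows "op_norm A \<le> op_norm B + (real CARD('n))\<^sup>2 * a"
proof -
  have "op_norm A = onorm (\<lambda>v. B *v v + (A - B) *v v)"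
    by (simp add: op_norm_def matrix_vector_mult_diff_rdistrib)
  also have "\<dots> \<le> op_norm B + onorm ((*v) (A - B))"
    unfolding op_norm_def by (intro onorm_triangle matrix_vector_mul_bounded_linear)
  also have "onorm ((*v) (A - B)) \<le> (real CARD('n))\<^sup>2 * a"
    using onorm_le_matrix_component[OF assms] by (simp add: power2_eq_square)
  finally show ?thesis by simp
qed

lemma measurable_transpose: "(transpose :: real^'n^'m \<Rightarrow> real^'m^'n) \<in> borel_measurable borel"
proof -
  have "linear (transpose :: real^'n^'m \<Rightarrow> real^'m^'n)"
    by (rule linearI) (auto simp: transpose_def vec_eq_iff)
  then show ?thesis
    by (intro borel_measurable_continuous_onI linear_continuous_on) (simp add: linear_conv_bounded_linear)
qed

theorem theorem6p6:
  fixes M :: "'w measure"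
    and Abar Tbar Dbar :: "real ^ ('n::{finite,linorder}) ^ ('n::{finite,linorder})"
    and T G\<^sub>D D A :: "'w \<Rightarrow> real ^ ('n::{finite,linorder}) ^ ('n::{finite,linorder})"
    and \<sigma> x :: real
  assumes "prob_space M"
    and "transpose Abar = Abar"
    and "Abar = Tbar + Dbar + transpose Tbar"
    and "op_norm Abar \<le> sqrt (real CARD('n))"
    and "strictly_lower_triangular Tbar"
    and "diagonal_matrix Dbar"
    and "0 < \<sigma>" and "\<sigma>\<^sup>2 \<le> 1"
    and "zero_preserving_perturbation M \<sigma> Tbar T"
    and "\<And>\<omega>. \<omega> \<in> space M \<Longrightarrow> diagonal_matrix (G\<^sub>D \<omega>)"
    and "indep_gaussians M \<sigma> (\<lambda>i \<omega>. G\<^sub>D \<omega> $ i $ i) UNIV"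
    and "prob_space.indep_var M borel T borel G\<^sub>D"
    and "\<And>\<omega>. \<omega> \<in> space M \<Longrightarrow> D \<omega> = Dbar + G\<^sub>D \<omega>"
    and "\<And>\<omega>. \<omega> \<in> space M \<Longrightarrow> A \<omega> = T \<omega> + D \<omega> + transpose (T \<omega>)"
    and "x \<ge> 1"
  shows "measure M {\<omega> \<in> space M. cond_number (A \<omega>) \<ge> x}
           \<le> 6 * sqrt (2 / pi) * (real CARD('n) powr (7 / 2) / (x * \<sigma>))
              * (1 + sqrt (2 * ln x / (9 * real CARD('n))))"
proof -
  interpret prob_space M by fact
  let ?n = "real CARD('n)"
  obtain g where g: "indep_gaussians M \<sigma> g {(i, j). Tbar $ i $ j \<noteq> 0}"
    and T: "\<And>\<omega> i j. \<omega> \<in> space M \<Longrightarrow>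
      T \<omega> $ i $ j = (if Tbar $ i $ j = 0 then 0 else Tbar $ i $ j + g (i, j) \<omega>)"
    using assms(9) unfolding zero_preserving_perturbation_def by blast
  note G = assms(10) and gG = assms(11) and ind = assms(12)
  have \<sigma>: "0 < \<sigma>" "\<sigma> \<le> 1" using assms(7,8) by (auto simp: power_le_one_iff abs_square_le_1)
  \<comment> \<open>Since \<open>\<sigma> \<le> 1\<close>, each Gaussian exceeds this level in
    modulus with probability at most \<open>2 * exp (- 1) / x\<close>.\<close>
  define a where "a = sqrt (2 * ln x + 2)"
  have a: "a > 0" using assms(15) by (simp add: a_def add_nonneg_pos)
  \<comment> \<open>The bound on the norm of \<open>A\<close> outside \<open>F\<close>:
    \<open>sqrt n\<close> from \<open>Abar\<close> and \<open>n^2 a\<close> from the noise.\<close>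
  define s where "s = sqrt ?n + ?n\<^sup>2 * a"
  have s: "s > 0" using a by (simp add: s_def add_pos_pos)
  define I where "I = {(i, j). Tbar $ i $ j \<noteq> 0}"
  define F where "F = (\<Union>p\<in>I. {\<omega> \<in> space M. a \<le> \<bar>g p \<omega>\<bar>}) \<union> (\<Union>i. {\<omega> \<in> space M. a \<le> \<bar>G\<^sub>D \<omega> $ i $ i\<bar>})"
  have dg: "distributed M lborel (g p) (normal_density 0 \<sigma>)" if "p \<in> I" for p
    using g that unfolding indep_gaussians_def I_def by blast
  have dG: "distributed M lborel (\<lambda>\<omega>. G\<^sub>D \<omega> $ i $ i) (normal_density 0 \<sigma>)" for i
    using gG by (simp add: indep_gaussians_def)
  have [measurable]: "T \<in> borel_measurable M" "G\<^sub>D \<in> borel_measurable M"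
    using ind by (auto simp: indep_var_distribution_eq)
  have mg: "{\<omega> \<in> space M. a \<le> \<bar>g p \<omega>\<bar>} \<in> events" if "p \<in> I" for p
    using distributed_measurable[OF dg[OF that]] by simp
  have mG: "{\<omega> \<in> space M. a \<le> \<bar>G\<^sub>D \<omega> $ i $ i\<bar>} \<in> events" for i
    using distributed_measurable[OF dG[of i]] by simp
  define e where "e = exp (- a\<^sup>2 / 2)"
  have "- a\<^sup>2 / (2 * \<sigma>\<^sup>2) \<le> - a\<^sup>2 / 2"
    using a assms(7,8) by (simp add: field_simps mult_le_cancel_left1)
  then have e: "2 * exp (- a\<^sup>2 / (2 * \<sigma>\<^sup>2)) \<le> 2 * e" by (simp add: e_def)
  \<comment> \<open>Each tail has probability at most \<open>2 * e\<close>. There are at most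
    \<open>n^2\<close> positions in \<open>I\<close> and \<open>n\<close> on the diagonal, the
    latter count being rounded up to \<open>n^2\<close>.\<close>
  have probF: "prob F \<le> 4 * ?n\<^sup>2 * e"
  proof -
    have e0: "0 \<le> 2 * e" by (simp add: e_def)
    have "prob F \<le> prob (\<Union>p\<in>I. {\<omega> \<in> space M. a \<le> \<bar>g p \<omega>\<bar>}) + prob (\<Union>i. {\<omega> \<in> space M. a \<le> \<bar>G\<^sub>D \<omega> $ i $ i\<bar>})"
      unfolding F_def using mg mG by (intro measure_Un_le) auto
    moreover have "prob (\<Union>p\<in>I. {\<omega> \<in> space M. a \<le> \<bar>g p \<omega>\<bar>}) \<le> ?n\<^sup>2 * (2 * e)"
    proof -
      have "prob (\<Union>p\<in>I. {\<omega> \<in> space M. a \<le> \<bar>g p \<omega>\<bar>}) \<le> (\<Sum>p\<in>I. prob {\<omega> \<in> space M. a \<le> \<bar>g p \<omega>\<bar>})"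
        using mg by (intro measure_UNION_le) auto
      also have "\<dots> \<le> real (card I) * (2 * e)"
        using normal_abs_tail[OF dg \<sigma>(1)] a e by (intro sum_bounded_above) (meson less_imp_le order_trans)
      also have "\<dots> \<le> ?n\<^sup>2 * (2 * e)"
        using card_mono[of "UNIV :: ('n \<times> 'n) set" I] e0
        by (intro mult_right_mono) (simp_all add: power2_eq_square flip: of_nat_mult)
      finally show ?thesis .
    qed
    moreover have "prob (\<Union>i. {\<omega> \<in> space M. a \<le> \<bar>G\<^sub>D \<omega> $ i $ i\<bar>}) \<le> ?n\<^sup>2 * (2 * e)"
    proof -
      have "prob (\<Union>i. {\<omega> \<in> space M. a \<le> \<bar>G\<^sub>D \<omega> $ i $ i\<bar>}) \<le> (\<Sum>i\<in>UNIV. prob {\<omega> \<in> space M. a \<le> \<bar>G\<^sub>D \<omega> $ i $ i\<bar>})"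
        using mG by (intro measure_UNION_le) auto
      also have "\<dots> \<le> ?n * (2 * e)"
        using normal_abs_tail[OF dG \<sigma>(1)] a e by (intro sum_bounded_above) (meson less_imp_le order_trans)
      also have "\<dots> \<le> ?n\<^sup>2 * (2 * e)"
        using e0 by (intro mult_right_mono) (simp_all add: power2_eq_square)
      finally show ?thesis .
    qed
    ultimately show ?thesis by simp
  qed
  have F: "F \<in> events" unfolding F_def using mg mG by (intro sets.Un sets.finite_UN) auto
  let ?E = "{\<omega> \<in> space M. cond_number (A \<omega>) \<ge> x}"
  have A: "A \<omega> = T \<omega> + transpose (T \<omega>) + Dbar + G\<^sub>D \<omega>" if "\<omega> \<in> space M" for \<omega>
    using assms(13,14) that by (simp add: algebra_simps)
  have norm_A: "op_norm (A \<omega>) \<le> s" if \<omega>: "\<omega> \<in> space M" "\<omega> \<notin> F" for \<omega>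
  proof -
    have gl: "\<bar>g p \<omega>\<bar> < a" if "p \<in> I" for p
      using \<omega> that by (auto simp: F_def not_le)
    have Gl: "\<bar>G\<^sub>D \<omega> $ i $ i\<bar> < a" for i
      using \<omega> by (auto simp: F_def not_le)
    have "\<bar>(A \<omega> - Abar) $ i $ j\<bar> \<le> a" for i j
    proof -
      \<comment> \<open>The three noise terms have disjoint supports: below, above and on the
        diagonal. So each entry is zero or a single Gaussian, and the bound is \<open>a\<close>
        rather than \<open>3 * a\<close>.\<close>
      have ent: "(A \<omega> - Abar) $ i $ j = (T \<omega> - Tbar) $ i $ j + (T \<omega> - Tbar) $ j $ i + G\<^sub>D \<omega> $ i $ j"
        using \<omega> by (simp add: A assms(3) transpose_def)
      have off: "\<bar>(T \<omega> - Tbar) $ k $ l\<bar> \<le> a" for k l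
        using gl[of "(k, l)"] a by (auto simp: T[OF \<omega>(1)] I_def)
      have zero: "(T \<omega> - Tbar) $ k $ l = 0" if "k \<le> l" for k l
        using assms(5) that by (auto simp: T[OF \<omega>(1)] strictly_lower_triangular_def)
      have diag: "G\<^sub>D \<omega> $ i $ j = 0" if "i \<noteq> j"
        using G[OF \<omega>(1)] that by (simp add: diagonal_matrix_def)
      consider "i < j" | "i = j" | "j < i" by force
      then show ?thesis
      proof cases
        case 1
        then show ?thesis unfolding ent using zero[of i j] diag off[of j i] by simp
      next
        case 2
        then show ?thesis unfolding ent using zero[of i i] Gl[of i] by simp
      next
        case 3
        then show ?thesis unfolding ent using zero[of j i] diag off[of i j] by simp
      qed
    qed
    from op_norm_perturbation[OF this] show ?thesis using assms(4) by (simp add: s_def)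
  qed
  have sym: "u \<bullet> (A \<omega> *v v) = v \<bullet> (A \<omega> *v u)" if "\<omega> \<in> space M" for \<omega> u v
  proof -
    have "transpose (A \<omega>) = A \<omega>"
      using assms(6) G[OF that] by (auto simp: A[OF that] transpose_def vec_eq_iff diagonal_matrix_def) metis
    then show ?thesis by (metis dot_lmul_matrix inner_commute transpose_matrix_vector)
  qed
  \<comment> \<open>The inequality on \<open>\<epsilon>\<close> is strict because
    \<open>neg_index_eigenvalue\<close> requires \<open>\<bar>\<mu>\<bar> < \<epsilon>\<close>,
    while the eigenvalue may have modulus exactly \<open>s / x\<close>.\<close>
  have main: "prob ?E \<le> 4 * ?n\<^sup>2 * e + ?n * (2 * \<epsilon> / (\<sigma> * sqrt (2 * pi)))" if \<epsilon>: "s / x < \<epsilon>" for \<epsilon>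
  proof -
    have \<epsilon>0: "0 \<le> \<epsilon>" using s assms(15) \<epsilon> by (smt (verit) divide_nonneg_nonneg)
    \<comment> \<open>Everything except \<open>G\<^sub>D\<close> is gathered here, lower shift
      included: \<open>K (T \<omega>) + G\<^sub>D \<omega>\<close> is
      \<open>A - \<epsilon> I\<close>, and a shift by \<open>2 * \<epsilon>\<close> reaches
      \<open>A + \<epsilon> I\<close>.\<close>
    define K where "K B = B + transpose B + Dbar - \<epsilon> *\<^sub>R mat 1" for B
    have K[measurable]: "K \<in> borel_measurable borel"
      unfolding K_def using measurable_transpose by measurable
    let ?N = "{\<omega> \<in> space M. neg_index (K (T \<omega>) + G\<^sub>D \<omega>) \<noteq> neg_index (K (T \<omega>) + G\<^sub>D \<omega> + (2 * \<epsilon>) *\<^sub>R mat 1)}"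
    have N: "?N \<in> events" by (intro sets_neg_index_neq; measurable)
    have "?E \<subseteq> F \<union> ?N"
    proof
      fix \<omega> assume "\<omega> \<in> ?E"
      then have \<omega>: "\<omega> \<in> space M" "x \<le> cond_number (A \<omega>)" by auto
      show "\<omega> \<in> F \<union> ?N"
      proof (cases "\<omega> \<in> F")
        case False
        have "0 < x" using assms(15) by simp
        from cond_number_eigenvalue[OF sym[OF \<omega>(1)] norm_A[OF \<omega>(1) False] s this \<omega>(2)]
        obtain w \<mu> where w: "w \<noteq> 0" "A \<omega> *v w = \<mu> *\<^sub>R w" "\<bar>\<mu>\<bar> \<le> s / x" by blast
        have "neg_index (A \<omega> + \<epsilon> *\<^sub>R mat 1) < neg_index (A \<omega> - \<epsilon> *\<^sub>R mat 1)"
          using neg_index_eigenvalue[OF sym[OF \<omega>(1)] w(2,1)] w(3) \<epsilon> by simp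
        moreover have "K (T \<omega>) + G\<^sub>D \<omega> = A \<omega> - \<epsilon> *\<^sub>R mat 1"
          by (simp add: K_def A[OF \<omega>(1)])
        moreover have "A \<omega> - \<epsilon> *\<^sub>R mat 1 + (2 * \<epsilon>) *\<^sub>R mat 1 = A \<omega> + \<epsilon> *\<^sub>R mat 1"
          unfolding mult_2 scaleR_left_distrib by simp
        ultimately have "neg_index (K (T \<omega>) + G\<^sub>D \<omega>) \<noteq> neg_index (K (T \<omega>) + G\<^sub>D \<omega> + (2 * \<epsilon>) *\<^sub>R mat 1)"
          by (metis less_irrefl)
        then show ?thesis using \<omega> by blast
      qed simp
    qed
    then have "prob ?E \<le> prob (F \<union> ?N)" using F N by (intro finite_measure_mono) auto
    also have "\<dots> \<le> prob F + prob ?N" using F N by (intro measure_Un_le)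
    also have "prob ?N \<le> ?n * (2 * \<epsilon> / (\<sigma> * sqrt (2 * pi)))"
      using neg_index_shift[OF ind G gG \<sigma>(1) _ K, of "2 * \<epsilon>"] \<epsilon>0 by simp
    finally show ?thesis using probF by simp
  qed
  \<comment> \<open>The bound is continuous in \<open>\<epsilon>\<close>, so it persists in the
    limit as \<open>\<epsilon>\<close> decreases to \<open>s / x\<close>.\<close>
  have "prob ?E \<le> 4 * ?n\<^sup>2 * e + ?n * (2 * (s / x) / (\<sigma> * sqrt (2 * pi)))"
  proof (rule tendsto_lowerbound)
    show "((\<lambda>\<epsilon>. 4 * ?n\<^sup>2 * e + ?n * (2 * \<epsilon> / (\<sigma> * sqrt (2 * pi)))) \<longlongrightarrow>
        4 * ?n\<^sup>2 * e + ?n * (2 * (s / x) / (\<sigma> * sqrt (2 * pi)))) (at_right (s / x))"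
      using \<sigma> by (intro tendsto_intros) auto
    show "\<forall>\<^sub>F \<epsilon> in at_right (s / x). prob ?E \<le> 4 * ?n\<^sup>2 * e + ?n * (2 * \<epsilon> / (\<sigma> * sqrt (2 * pi)))"
      using main by (auto simp: eventually_at_right_field intro: exI[of _ "s / x + 1"])
  qed simp
  also have "\<dots> \<le> 6 * sqrt (2 / pi) * (?n powr (7 / 2) / (x * \<sigma>)) * (1 + sqrt (2 * ln x / (9 * ?n)))"
    unfolding e_def s_def a_def using \<sigma> assms(15) by (intro final_numeric_bound) auto
  finally show ?thesis .
qed

end
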